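(* Let $n\ge1$, let $\alpha\in\mathcal{T}_n$ be an idempotent of rank $l\ge2$, and consider the variant $(\mathcal{T}_n,* )$ with $\beta*\gamma=\beta\alpha\gamma$. Let $T$ be an isolated subsemigroup of $(\mathcal{T}_n,* )$ contained in $\mathcal{T}_n^{(l-1)}$. Then one of the following holds: - $T=H(k,m,X,Y)$ for some $k,m\in\{1,\dots,l\}$, $k\neq m$, $\varnothing\ne X\subseteq\mathcal{U}^{(k,m)}$, $\varnothing\neq Y\subseteq\mathcal{V}^{(k)}$; - $T=K(\{k,m\},X)$ for some $k,m\in\{1,\dots,l\}$, $k\ne m$, $\varnothing\ne X\subseteq\mathcal{U}^{(k,m)}$; - $T=L(k,M,Y)$ for some $k\in\{1,\dots,l\}$, $M\subseteq\{a_1,\dots,a_{k-1},a_{k+1},\dots,a_l\}$ with $|M|>1$, and $\varnothing\ne Y\subseteq\mathcal{V}^{(k)}$.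
   Context: Subsemigroups are non-empty. A subsemigroup $T$ of a semigroup $S$ is isolated if for all $x\in S$: $x^j\in T$ for some $j>0$ implies $x\in T$. $N=\{1,\dots,n\}$; $\mathcal{T}_n$ is the set of all maps $N\to N$, composed from left to right: $(\beta\gamma)(x)=\gamma(\beta(x))$. $\operatorname{im}(\beta)$ is the image of $\beta$, $\operatorname{rank}(\beta)=|\operatorname{im}(\beta)|$, and $\Lambda_\beta$ is the kernel of $\beta$: the equivalence relation (partition of $N$) $x\,\Lambda_\beta\, y\iff\beta(x)=\beta(y)$. $\alpha\in\mathcal{T}_n$ is an idempotent ($\alpha\alpha=\alpha$) of rank $l$ with kernel blocks $A_1,\dots,A_l$ and image $A=\{a_1,\dots,a_l\}$, where $\alpha(A_i)=\{a_i\}$, so $a_i\in A_i$. The variant $(\mathcal{T}_n,* )$ has operation $\beta*\gamma=\beta\alpha\gamma$; all idempotents and powers are taken with respect to $*$. For an idempotent $\varepsilon$ of $(\mathcal{T}_n,* )$, $\sqrt{\varepsilon}$ is the set of all $\beta$ some $*$-power of which equals $\varepsilon$. For $\beta\in\mathcal{T}_n$ let $\varepsilon$ be the unique idempotent in the cyclic subsemigroup of $(\mathcal{T}_n,* )$ generated by $\beta$; the stable rank of $\beta$ is $\operatorname{rank}(\varepsilon)$. $\mathcal{T}_n^{(i)}$ is the set of elements of stable rank $i$. Let $\varepsilon$ be an idempotent of $(\mathcal{T}_n,* )$ of rank $l-1$. Then the elements of $\operatorname{im}(\varepsilon)$ lie in pairwise different blocks $A_i$, and there is a unique pair $\{a_m,a_k\}$,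 $m\neq k$, of elements of $A$ contained in a common block of $\Lambda_\varepsilon$, labelled so that $\varepsilon(a_m)=\varepsilon(a_k)\in A_m$ (then $A_k\cap\operatorname{im}(\varepsilon)=\varnothing$). Put $\mathfrak{t}(\varepsilon)=a_k$, $\mathfrak{b}(\varepsilon)=a_m$, and for $\beta\in\sqrt{\varepsilon}$ put $\mathfrak{t}(\beta)=\mathfrak{t}(\varepsilon)$, $\mathfrak{b}(\beta)=\mathfrak{b}(\varepsilon)$. $\mathcal{T}_n^{(l-1,k)}$ is the set of $\beta\in\mathcal{T}_n^{(l-1)}$ with $\mathfrak{t}(\beta)=a_k$, and $\mathcal{T}_n^{(l-1,k,m)}$ is the set of $\beta\in\mathcal{T}_n^{(l-1,k)}$ with $\mathfrak{b}(\beta)=a_m$. For $k\ne m$, $\mathcal{U}^{(k,m)}=\mathcal{U}^{(m,k)}$ is the set of all partitions of $N$ into $l-1$ blocks such that every block contains at least one element of $A$ and $a_k,a_m$ lie in the same block. $\mathcal{V}^{(k)}$ is the set of all sets $\{b_i: i\in\{1,\dots,l\},\,i\ne k\}$ with $b_i\in A_i$. Then: - $H(k,m,X,Y)$ is the union of all $\sqrt{\varepsilon}$ with $\varepsilon\in\mathcal{T}_n^{(l-1,k,m)}$ an idempotent, $\Lambda_\varepsilon\in X$, $\operatorname{im}(\varepsilon)\in Y$; - $K(\{k,m\},X)$ is the union of all $\sqrt{\varepsilon}$ with $\varepsilon\in\mathcal{T}_n^{(l-1,k,m)}\cup\mathcal{T}_n^{(l-1,m,k)}$ an idempotent, $\Lambda_\varepsilon\in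 X$; - $L(k,M,Y)$ is the union of all $\sqrt{\varepsilon}$ with $\varepsilon\in\mathcal{T}_n^{(l-1,k)}$ an idempotent, $\mathfrak{b}(\varepsilon)\in M$, $\operatorname{im}(\varepsilon)\in Y$. *)

theory Defs
  imports Complex_Main "HOL-Library.FuncSet" "HOL-Library.Disjoint_Sets"
begin

section \<open>Semigroups given by a carrier and an operation\<close>

text \<open>\<open>x\<close> to the power \<open>j\<close>, meaningful for positive \<open>j\<close> only.\<close>

definition spow :: "('a \<Rightarrow> 'a \<Rightarrow> 'a) \<Rightarrow> 'a \<Rightarrow> nat \<Rightarrow> 'a" where
  "spow mult x j = ((\<lambda>y. mult y x) ^^ (j - 1)) x"

definition subsemigroup :: "'a set \<Rightarrow> ('a \<Rightarrow> 'a \<Rightarrow> 'a) \<Rightarrow> 'a set \<Rightarrow> bool" where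
  "subsemigroup S mult T \<longleftrightarrow>
     T \<subseteq> S \<and> T \<noteq> {} \<and> (\<forall>x\<in>T. \<forall>y\<in>T. mult x y \<in> T)"

definition isolated_subsemigroup :: "'a set \<Rightarrow> ('a \<Rightarrow> 'a \<Rightarrow> 'a) \<Rightarrow> 'a set \<Rightarrow> bool" where
  "isolated_subsemigroup S mult T \<longleftrightarrow>
     subsemigroup S mult T \<and> (\<forall>x\<in>S. (\<exists>j>0. spow mult x j \<in> T) \<longrightarrow> x \<in> T)"

definition idempotents :: "'a set \<Rightarrow> ('a \<Rightarrow> 'a \<Rightarrow> 'a) \<Rightarrow> 'a set" where
  "idempotents S mult = {e \<in> S. mult e e = e}"


section \<open>Transformations and the variant operation\<close>

text \<open>A self-map of \<open>{1..n}\<close> is represented by a function that is \<open>undefined\<close>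
  outside \<open>{1..n}\<close>, so that equality of functions is equality of maps.\<close>

definition trans_maps :: "nat \<Rightarrow> (nat \<Rightarrow> nat) set" where
  "trans_maps n = {1..n} \<rightarrow>\<^sub>E {1..n}"

text \<open>Products are read from left to right.\<close>

definition tmult :: "nat \<Rightarrow> (nat \<Rightarrow> nat) \<Rightarrow> (nat \<Rightarrow> nat) \<Rightarrow> (nat \<Rightarrow> nat)" where
  "tmult n \<beta> \<gamma> = compose {1..n} \<gamma> \<beta>"

definition vmult :: "nat \<Rightarrow> (nat \<Rightarrow> nat) \<Rightarrow> (nat \<Rightarrow> nat) \<Rightarrow> (nat \<Rightarrow> nat) \<Rightarrow> (nat \<Rightarrow> nat)" where
  "vmult n \<alpha> \<beta> \<gamma> = tmult n (tmult n \<beta> \<alpha>) \<gamma>"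

definition im :: "nat \<Rightarrow> (nat \<Rightarrow> nat) \<Rightarrow> nat set" where
  "im n \<beta> = \<beta> ` {1..n}"

definition rank :: "nat \<Rightarrow> (nat \<Rightarrow> nat) \<Rightarrow> nat" where
  "rank n \<beta> = card (im n \<beta>)"

text \<open>The kernel, as a partition of \<open>{1..n}\<close>.\<close>

definition kernel :: "nat \<Rightarrow> (nat \<Rightarrow> nat) \<Rightarrow> nat set set" where
  "kernel n \<beta> = {1..n} // {(x, y). x \<in> {1..n} \<and> y \<in> {1..n} \<and> \<beta> x = \<beta> y}"

definition vidempotents :: "nat \<Rightarrow> (nat \<Rightarrow> nat) \<Rightarrow> (nat \<Rightarrow> nat) set" where
  "vidempotents n \<alpha> = idempotents (trans_maps n) (vmult n \<alpha>)"

definition vroot :: "nat \<Rightarrow> (nat \<Rightarrow> nat) \<Rightarrow> (nat \<Rightarrow> nat) \<Rightarrow> (nat \<Rightarrow> nat) set" where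
  "vroot n \<alpha> \<epsilon> = {\<beta> \<in> trans_maps n. \<exists>j>0. spow (vmult n \<alpha>) \<beta> j = \<epsilon>}"

text \<open>The unique idempotent in the cyclic subsemigroup generated by \<open>\<beta>\<close>.\<close>

definition stable_idem :: "nat \<Rightarrow> (nat \<Rightarrow> nat) \<Rightarrow> (nat \<Rightarrow> nat) \<Rightarrow> (nat \<Rightarrow> nat)" where
  "stable_idem n \<alpha> \<beta> =
     (THE \<epsilon>. \<epsilon> \<in> vidempotents n \<alpha> \<and> (\<exists>j>0. \<epsilon> = spow (vmult n \<alpha>) \<beta> j))"

definition stable_rank :: "nat \<Rightarrow> (nat \<Rightarrow> nat) \<Rightarrow> (nat \<Rightarrow> nat) \<Rightarrow> nat" where
  "stable_rank n \<alpha> \<beta> = rank n (stable_idem n \<alpha> \<beta>)"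

definition T_stable :: "nat \<Rightarrow> (nat \<Rightarrow> nat) \<Rightarrow> nat \<Rightarrow> (nat \<Rightarrow> nat) set" where
  "T_stable n \<alpha> i = {\<beta> \<in> trans_maps n. stable_rank n \<alpha> \<beta> = i}"


section \<open>Stable rank one less than the rank of \<open>\<alpha>\<close>\<close>

text \<open>The block of the kernel of \<open>\<alpha>\<close> that is mapped to \<open>c\<close>.\<close>

definition block :: "nat \<Rightarrow> (nat \<Rightarrow> nat) \<Rightarrow> nat \<Rightarrow> nat set" where
  "block n \<alpha> c = {x \<in> {1..n}. \<alpha> x = c}"

text \<open>For an idempotent \<open>\<epsilon>\<close> of the variant whose rank is one less than that of \<open>\<alpha>\<close>:
  the pair consisting of \<open>\<tt>(\<epsilon>)\<close> and \<open>\<bb>(\<epsilon>)\<close>, in this order.\<close>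

definition merged_pair :: "nat \<Rightarrow> (nat \<Rightarrow> nat) \<Rightarrow> (nat \<Rightarrow> nat) \<Rightarrow> nat \<times> nat" where
  "merged_pair n \<alpha> \<epsilon> =
     (THE (t, b). t \<in> im n \<alpha> \<and> b \<in> im n \<alpha> \<and> t \<noteq> b \<and> \<epsilon> t = \<epsilon> b \<and> \<epsilon> b \<in> block n \<alpha> b)"

definition tt :: "nat \<Rightarrow> (nat \<Rightarrow> nat) \<Rightarrow> (nat \<Rightarrow> nat) \<Rightarrow> nat" where
  "tt n \<alpha> \<beta> = fst (merged_pair n \<alpha> (stable_idem n \<alpha> \<beta>))"

definition bb :: "nat \<Rightarrow> (nat \<Rightarrow> nat) \<Rightarrow> (nat \<Rightarrow> nat) \<Rightarrow> nat" where
  "bb n \<alpha> \<beta> = snd (merged_pair n \<alpha> (stable_idem n \<alpha> \<beta>))"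

text \<open>From here on, \<open>l\<close> is the rank of \<open>\<alpha>\<close> and \<open>a\<close> enumerates its image as
  \<open>a 1, \<dots>, a l\<close>; thus \<open>block n \<alpha> (a i)\<close> is the kernel block \<open>A\<^sub>i\<close> containing \<open>a i\<close>.\<close>

definition T_top ::
  "nat \<Rightarrow> nat \<Rightarrow> (nat \<Rightarrow> nat) \<Rightarrow> (nat \<Rightarrow> nat) \<Rightarrow> nat \<Rightarrow> (nat \<Rightarrow> nat) set" where
  "T_top n l \<alpha> a k = {\<beta> \<in> T_stable n \<alpha> (l - 1). tt n \<alpha> \<beta> = a k}"

definition T_top_bot ::
  "nat \<Rightarrow> nat \<Rightarrow> (nat \<Rightarrow> nat) \<Rightarrow> (nat \<Rightarrow> nat) \<Rightarrow> nat \<Rightarrow> nat \<Rightarrow> (nat \<Rightarrow> nat) set" where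
  "T_top_bot n l \<alpha> a k m = {\<beta> \<in> T_top n l \<alpha> a k. bb n \<alpha> \<beta> = a m}"

definition U :: "nat \<Rightarrow> nat \<Rightarrow> (nat \<Rightarrow> nat) \<Rightarrow> (nat \<Rightarrow> nat) \<Rightarrow> nat \<Rightarrow> nat \<Rightarrow> nat set set set" where
  "U n l \<alpha> a k m =
     {P. partition_on {1..n} P \<and> card P = l - 1 \<and> (\<forall>B\<in>P. B \<inter> im n \<alpha> \<noteq> {}) \<and>
         (\<exists>B\<in>P. a k \<in> B \<and> a m \<in> B)}"

definition V :: "nat \<Rightarrow> nat \<Rightarrow> (nat \<Rightarrow> nat) \<Rightarrow> (nat \<Rightarrow> nat) \<Rightarrow> nat \<Rightarrow> nat set set" where
  "V n l \<alpha> a k = {b ` ({1..l} - {k}) | b. \<forall>i\<in>{1..l} - {k}. b i \<in> block n \<alpha> (a i)}"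

definition H ::
  "nat \<Rightarrow> nat \<Rightarrow> (nat \<Rightarrow> nat) \<Rightarrow> (nat \<Rightarrow> nat) \<Rightarrow> nat \<Rightarrow> nat \<Rightarrow> nat set set set \<Rightarrow> nat set set
    \<Rightarrow> (nat \<Rightarrow> nat) set" where
  "H n l \<alpha> a k m X Y =
     (\<Union>\<epsilon> \<in> {\<epsilon> \<in> vidempotents n \<alpha>. \<epsilon> \<in> T_top_bot n l \<alpha> a k m \<and>
                kernel n \<epsilon> \<in> X \<and> im n \<epsilon> \<in> Y}. vroot n \<alpha> \<epsilon>)"

definition K ::
  "nat \<Rightarrow> nat \<Rightarrow> (nat \<Rightarrow> nat) \<Rightarrow> (nat \<Rightarrow> nat) \<Rightarrow> nat \<Rightarrow> nat \<Rightarrow> nat set set set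
    \<Rightarrow> (nat \<Rightarrow> nat) set" where
  "K n l \<alpha> a k m X =
     (\<Union>\<epsilon> \<in> {\<epsilon> \<in> vidempotents n \<alpha>.
                \<epsilon> \<in> T_top_bot n l \<alpha> a k m \<union> T_top_bot n l \<alpha> a m k \<and>
                kernel n \<epsilon> \<in> X}. vroot n \<alpha> \<epsilon>)"

definition L ::
  "nat \<Rightarrow> nat \<Rightarrow> (nat \<Rightarrow> nat) \<Rightarrow> (nat \<Rightarrow> nat) \<Rightarrow> nat \<Rightarrow> nat set \<Rightarrow> nat set set
    \<Rightarrow> (nat \<Rightarrow> nat) set" where
  "L n l \<alpha> a k M Y =
     (\<Union>\<epsilon> \<in> {\<epsilon> \<in> vidempotents n \<alpha>. \<epsilon> \<in> T_top n l \<alpha> a k \<and>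
                bb n \<alpha> \<epsilon> \<in> M \<and> im n \<epsilon> \<in> Y}. vroot n \<alpha> \<epsilon>)"

end

(* An isolated subsemigroup T is the union of the roots of its idempotents.  An idempotent
   e of rank l - 1 is determined by its kernel and its image, and it fixes the blocks A_i up to
   merging t(e) into b(e).  Since products in T keep stable rank l - 1, two idempotents of T
   have either the same t or the same pair {t, b} in opposite order; in both cases e * f is the
   idempotent with the kernel of e and the image of f, so the idempotents of T form a rectangular
   band.  If t and b are constant, this is case H.  If both orders of a pair occur, or if t is
   constant and b is not, isolation gives more: for an idempotent h of T one builds g with
   g * g = h, hence g in T, such that g * f * g differs from h in one prescribed point of the
   image (case K) or in the class of one prescribed point (case L).  Repeating this, all images
   respectively all kernels occur. *)

theory Submission
  imports Defs "HOL-Combinatorics.Transposition"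
begin

section \<open>Powers in a finite semigroup\<close>

locale finite_semigroup_on =
  fixes S :: "'a set" and mult :: "'a \<Rightarrow> 'a \<Rightarrow> 'a"
  assumes fin: "finite S"
    and closed: "x \<in> S \<Longrightarrow> y \<in> S \<Longrightarrow> mult x y \<in> S"
    and assoc: "x \<in> S \<Longrightarrow> y \<in> S \<Longrightarrow> z \<in> S \<Longrightarrow> mult (mult x y) z = mult x (mult y z)"
begin

lemma spow_1 [simp]: "spow mult x (Suc 0) = x"
  by (simp add: spow_def)

lemma spow_Suc: "j > 0 \<Longrightarrow> spow mult x (Suc j) = mult (spow mult x j) x"
  by (cases j) (simp_all add: spow_def)

lemma spow_2: "spow mult x 2 = mult x x"
  using spow_Suc [of 1 x] by (simp add: numeral_2_eq_2)

lemma spow_mem: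
  assumes "subsemigroup S mult T" "x \<in> T" "j > 0"
  shows "spow mult x j \<in> T"
  using \<open>j > 0\<close>
proof (induction j)
  case (Suc j)
  then show ?case
    using assms by (cases "j = 0") (auto simp: spow_Suc subsemigroup_def)
qed simp

lemma spow_closed: "x \<in> S \<Longrightarrow> j > 0 \<Longrightarrow> spow mult x j \<in> S"
  by (rule spow_mem) (auto simp: subsemigroup_def closed)

lemma spow_add:
  assumes "x \<in> S" "i > 0" "j > 0"
  shows "spow mult x (i + j) = mult (spow mult x i) (spow mult x j)"
  using \<open>j > 0\<close>
proof (induction j)
  case (Suc j)
  show ?case
  proof (cases "j = 0")
    case True
    then show ?thesis using assms by (simp add: spow_Suc)
  next
    case False
    then show ?thesis
      using Suc assms by (simp add: spow_Suc assoc spow_closed)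
  qed
qed simp

lemma spow_idempotent:
  assumes "e \<in> idempotents S mult" "j > 0"
  shows "spow mult e j = e"
  using \<open>j > 0\<close>
proof (induction j)
  case (Suc j)
  then show ?case
    using assms(1) by (cases "j = 0") (auto simp: spow_Suc idempotents_def)
qed simp

text \<open>By pigeonhole the powers of \<open>x\<close> are periodic with some period
  \<open>d\<close> from some exponent \<open>i\<close> on. The exponent \<open>i * d\<close> is at
  least \<open>i\<close> and a multiple of \<open>d\<close>, so doubling it does not change the
  power.\<close>

lemma ex_idempotent_spow:
  assumes "x \<in> S"
  shows "\<exists>j>0. spow mult x j \<in> idempotents S mult"
proof -
  \<comment> \<open>\<open>spow\<close> at exponent 0 is also \<open>x\<close>. Exponents are
    shifted by one, as the pigeonhole argument could otherwise return the empty coincidence of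
    exponents 0 and 1.\<close>
  have "range (\<lambda>j. spow mult x (Suc j)) \<subseteq> S"
    using assms by (auto intro: spow_closed)
  then have "\<not> inj (\<lambda>j. spow mult x (Suc j))"
    using fin finite_imageD [of _ UNIV] by (meson finite_subset infinite_UNIV_nat)
  then obtain i' j' where ij: "i' < j'" "spow mult x (Suc i') = spow mult x (Suc j')"
    unfolding inj_def by (metis linorder_neqE_nat)
  define i d where "i = Suc i'" and "d = j' - i'"
  have i: "i > 0" and d: "d > 0" and eq: "spow mult x (i + d) = spow mult x i"
    using ij by (auto simp: i_def d_def)
  have shift: "spow mult x (m + d) = spow mult x m" if "m \<ge> i" for m
  proof (cases "m = i")
    case False
    then have "m = i + (m - i)" "m - i > 0"
      using that by auto
    then show ?thesis
      using spow_add [of x "i + d" "m - i"] spow_add [of x i "m - i"] eq i assms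
      by (metis add.assoc add.commute trans_less_add1)
  qed (use eq in simp)
  have "spow mult x (i * d + q * d) = spow mult x (i * d)" for q
  proof (induction q)
    case (Suc q)
    have "i \<le> i * d + q * d"
      using d by (simp add: trans_le_add1)
    then show ?case
      using shift [of "i * d + q * d"] Suc by (simp add: algebra_simps)
  qed simp
  from this [of i] have "spow mult x (i * d) \<in> idempotents S mult"
    using spow_add [of x "i * d" "i * d"] i d assms
    by (simp add: idempotents_def spow_closed)
  then show ?thesis
    using i d by (intro exI [of _ "i * d"]) simp
qed

end


section \<open>Idempotents of the variant of corank one\<close>

locale variant_semigroup =
  fixes n :: nat and \<alpha> :: "nat \<Rightarrow> nat"
  assumes \<alpha>_idem: "\<alpha> \<in> idempotents (trans_maps n) (tmult n)"
begin

abbreviation N where "N \<equiv> {1..n}"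
abbreviation A where "A \<equiv> im n \<alpha>"
abbreviation vm (infixl "\<star>" 70) where "\<beta> \<star> \<gamma> \<equiv> vmult n \<alpha> \<beta> \<gamma>"

declare One_nat_def [simp del] atLeastAtMost_iff [simp del]

section \<open>The idempotent \<alpha> and the variant as a finite semigroup\<close>

lemma \<alpha>_N: "x \<in> N \<Longrightarrow> \<alpha> x \<in> N"
  using \<alpha>_idem by (auto simp: idempotents_def trans_maps_def)

lemma \<alpha>_A: "x \<in> N \<Longrightarrow> \<alpha> x \<in> A"
  by (auto simp: im_def)

lemma A_N: "c \<in> A \<Longrightarrow> c \<in> N"
  using \<alpha>_N by (auto simp: im_def)

lemma fin_A: "finite A"
  by (simp add: im_def)

lemma \<alpha>_id: "c \<in> A \<Longrightarrow> \<alpha> c = c"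
proof -
  assume "c \<in> A"
  then obtain x where "x \<in> N" "c = \<alpha> x" by (auto simp: im_def)
  moreover have "tmult n \<alpha> \<alpha> x = \<alpha> x"
    using \<alpha>_idem by (simp add: idempotents_def)
  ultimately show ?thesis
    by (simp add: tmult_def compose_def)
qed

lemma trans_N: "\<beta> \<in> trans_maps n \<Longrightarrow> x \<in> N \<Longrightarrow> \<beta> x \<in> N"
  by (auto simp: trans_maps_def)

lemma trans_eqI:
  assumes "\<beta> \<in> trans_maps n" "\<gamma> \<in> trans_maps n" "\<And>x. x \<in> N \<Longrightarrow> \<beta> x = \<gamma> x"
  shows "\<beta> = \<gamma>"
  using assms unfolding trans_maps_def by (rule PiE_ext)

lemma vmult_apply: "x \<in> N \<Longrightarrow> (\<beta> \<star> \<gamma>) x = \<gamma> (\<alpha> (\<beta> x))"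
  by (simp add: vmult_def tmult_def compose_def)

lemma vmult_closed:
  assumes "\<beta> \<in> trans_maps n" "\<gamma> \<in> trans_maps n"
  shows "\<beta> \<star> \<gamma> \<in> trans_maps n"
proof -
  have "\<beta> \<star> \<gamma> = (\<lambda>x\<in>N. \<gamma> (\<alpha> (\<beta> x)))"
    by (auto simp: vmult_def tmult_def compose_def)
  then show ?thesis
    using trans_N [OF assms(1)] trans_N [OF assms(2)] \<alpha>_N
    unfolding trans_maps_def by (simp add: Pi_iff)
qed

sublocale finite_semigroup_on "trans_maps n" "vmult n \<alpha>"
proof
  show "finite (trans_maps n)"
    unfolding trans_maps_def by (intro finite_PiE) auto
  show "\<beta> \<star> \<gamma> \<star> \<delta> = \<beta> \<star> (\<gamma> \<star> \<delta>)"
    if "\<beta> \<in> trans_maps n" "\<gamma> \<in> trans_maps n" "\<delta> \<in> trans_maps n" for \<beta> \<gamma> \<delta>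
    using that
    by (intro trans_eqI vmult_closed) (simp_all add: vmult_apply trans_N \<alpha>_N)
qed (rule vmult_closed)

lemma vidempotents_iff:
  "\<epsilon> \<in> vidempotents n \<alpha> \<longleftrightarrow> \<epsilon> \<in> trans_maps n \<and> (\<forall>x\<in>N. \<epsilon> (\<alpha> (\<epsilon> x)) = \<epsilon> x)"
proof -
  have "\<epsilon> \<star> \<epsilon> = \<epsilon> \<longleftrightarrow> (\<forall>x\<in>N. \<epsilon> (\<alpha> (\<epsilon> x)) = \<epsilon> x)" if "\<epsilon> \<in> trans_maps n"
    using that by (metis trans_eqI vmult_apply vmult_closed)
  then show ?thesis
    by (auto simp: vidempotents_def idempotents_def)
qed

text \<open>All powers of an idempotent coincide, so the description has only one candidate.\<close>

lemma stable_idem_vidempotent: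
  assumes "\<epsilon> \<in> vidempotents n \<alpha>"
  shows "stable_idem n \<alpha> \<epsilon> = \<epsilon>"
  unfolding stable_idem_def
proof (rule the_equality)
  show "\<epsilon> \<in> vidempotents n \<alpha> \<and> (\<exists>j>0. \<epsilon> = spow (vmult n \<alpha>) \<epsilon> j)"
    using assms by (auto intro!: exI [of _ "Suc 0"])
qed (use assms in \<open>auto simp: vidempotents_def spow_idempotent\<close>)

section \<open>Shape of the idempotents of corank one\<close>

text \<open>\<open>t\<close> and \<open>b\<close> are \<open>\<tt>(\<epsilon>)\<close> and \<open>\<bb>(\<epsilon>)\<close>. For \<open>x \<in> N\<close>, the value \<open>\<alpha> (\<epsilon> x)\<close> names the
  kernel block of \<open>x\<close>.\<close>

definition corank1 :: "(nat \<Rightarrow> nat) \<Rightarrow> nat \<Rightarrow> nat \<Rightarrow> bool" where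
  "corank1 \<epsilon> t b \<longleftrightarrow> \<epsilon> \<in> vidempotents n \<alpha> \<and> t \<in> A \<and> b \<in> A \<and> t \<noteq> b \<and>
     (\<forall>c\<in>A - {t}. \<alpha> (\<epsilon> c) = c) \<and> \<epsilon> t = \<epsilon> b"

lemma corank1D:
  assumes "corank1 \<epsilon> t b"
  shows "\<epsilon> \<in> vidempotents n \<alpha>" "\<epsilon> \<in> trans_maps n" "t \<in> A" "b \<in> A" "t \<noteq> b"
    and "\<And>c. c \<in> A \<Longrightarrow> c \<noteq> t \<Longrightarrow> \<alpha> (\<epsilon> c) = c"
    and "\<epsilon> t = \<epsilon> b" "\<alpha> (\<epsilon> t) = b"
    and "\<And>x. x \<in> N \<Longrightarrow> \<epsilon> (\<alpha> (\<epsilon> x)) = \<epsilon> x"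
  using assms unfolding corank1_def vidempotents_iff by auto

text \<open>If \<open>\<alpha> (\<epsilon> x)\<close> were \<open>t\<close>, applying
  \<open>\<epsilon>\<close> would give \<open>\<epsilon> x = \<epsilon> t\<close>, hence
  \<open>t = \<alpha> (\<epsilon> t) = b\<close>. So the image avoids the block of
  \<open>t\<close>.\<close>

lemma corank1_class:
  assumes "corank1 \<epsilon> t b" "x \<in> N"
  shows "\<alpha> (\<epsilon> x) \<in> A" "\<alpha> (\<epsilon> x) \<noteq> t"
proof -
  show "\<alpha> (\<epsilon> x) \<in> A"
    using assms corank1D(2) trans_N \<alpha>_A by blast
  show "\<alpha> (\<epsilon> x) \<noteq> t"
    using corank1D(5,8) [OF assms(1)] corank1D(9) [OF assms] by metis
qed

text \<open>\<open>\<epsilon>\<close> recovers the value \<open>\<epsilon> x\<close> from its label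
  \<open>\<alpha> (\<epsilon> x)\<close>. This lets kernel classes be named by elements of
  \<open>A - {t}\<close>.\<close>

lemma corank1_eq_iff:
  assumes "corank1 \<epsilon> t b" "x \<in> N" "y \<in> N"
  shows "\<epsilon> x = \<epsilon> y \<longleftrightarrow> \<alpha> (\<epsilon> x) = \<alpha> (\<epsilon> y)"
  using assms corank1D(9) by metis

lemma corank1_im:
  assumes "corank1 \<epsilon> t b"
  shows "im n \<epsilon> = \<epsilon> ` (A - {t})"
proof -
  have "\<epsilon> x \<in> \<epsilon> ` (A - {t})" if "x \<in> N" for x
    using corank1D(9) [OF assms that] corank1_class [OF assms that]
    by (metis Diff_iff empty_iff image_eqI insert_iff)
  then show ?thesis
    using A_N unfolding im_def by blast
qed

lemma corank1_inj:
  assumes "corank1 \<epsilon> t b"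
  shows "inj_on \<epsilon> (A - {t})"
  by (rule inj_on_inverseI [where g = \<alpha>]) (use assms corank1D(6) in auto)

lemma corank1_rank:
  assumes "corank1 \<epsilon> t b"
  shows "rank n \<epsilon> = card A - 1"
  using corank1_im [OF assms] card_image [OF corank1_inj [OF assms]] corank1D(3) [OF assms] fin_A
  by (simp add: rank_def)

text \<open>Since \<open>\<epsilon>\<close> inverts \<open>\<alpha>\<close> on
  \<open>im n \<epsilon>\<close>, the image meets \<open>card A - 1\<close> different blocks. The
  element of \<open>A\<close> whose block is missed is \<open>t\<close>, and \<open>b\<close> labels
  the block to which \<open>t\<close> is sent.\<close>

lemma ex_corank1:
  assumes \<epsilon>: "\<epsilon> \<in> vidempotents n \<alpha>" and r: "rank n \<epsilon> = card A - 1" "card A \<ge> 2"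
  shows "\<exists>t b. corank1 \<epsilon> t b"
proof -
  have tr: "\<epsilon> \<in> trans_maps n" and id: "\<And>x. x \<in> N \<Longrightarrow> \<epsilon> (\<alpha> (\<epsilon> x)) = \<epsilon> x"
    using \<epsilon> by (auto simp: vidempotents_iff)
  define C where "C = (\<lambda>x. \<alpha> (\<epsilon> x)) ` N"
  have fixC: "\<alpha> (\<epsilon> c) = c" if "c \<in> C" for c
    using that id by (auto simp: C_def)
  have CA: "C \<subseteq> A"
    using tr trans_N \<alpha>_A by (auto simp: C_def)
  have "inj_on \<alpha> (im n \<epsilon>)"
    by (rule inj_on_inverseI [where g = \<epsilon>]) (use id in \<open>auto simp: im_def\<close>)
  then have "card C = card A - 1"
    using r card_image unfolding rank_def C_def im_def image_image [symmetric, of \<alpha> \<epsilon>] by fastforce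
  then have "card (A - C) = 1"
    using CA fin_A r(2) by (simp add: card_Diff_subset finite_subset)
  then obtain t where t: "A - C = {t}"
    by (rule card_1_singletonE)
  define b where "b = \<alpha> (\<epsilon> t)"
  have tN: "t \<in> N"
    using t A_N by blast
  then have "b \<in> C"
    by (auto simp: b_def C_def)
  moreover have "\<epsilon> t = \<epsilon> b"
    using id [OF tN] by (simp add: b_def)
  ultimately have "corank1 \<epsilon> t b"
    using \<epsilon> t CA fixC unfolding corank1_def by blast
  then show ?thesis by blast
qed

text \<open>For a competing pair, \<open>\<alpha> (\<epsilon> t') = b'\<close> differs from
  \<open>t'\<close>. Only \<open>t\<close> in \<open>A\<close> leaves its block, so
  \<open>t' = t\<close>, and then \<open>b' = \<alpha> (\<epsilon> t) = b\<close>.\<close>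

lemma corank1_merged_pair:
  assumes "corank1 \<epsilon> t b"
  shows "merged_pair n \<alpha> \<epsilon> = (t, b)"
  unfolding merged_pair_def
proof (rule the_equality)
  note D = corank1D [OF assms]
  show "case (t, b) of (t, b) \<Rightarrow>
    t \<in> A \<and> b \<in> A \<and> t \<noteq> b \<and> \<epsilon> t = \<epsilon> b \<and> \<epsilon> b \<in> block n \<alpha> b"
    using D(3-8) trans_N [OF D(2) A_N [OF D(4)]] by (simp add: block_def)
  fix p
  assume "case p of (t', b') \<Rightarrow>
    t' \<in> A \<and> b' \<in> A \<and> t' \<noteq> b' \<and> \<epsilon> t' = \<epsilon> b' \<and> \<epsilon> b' \<in> block n \<alpha> b'"
  then obtain t' b' where p: "p = (t', b')" "t' \<in> A" "b' \<in> A" "t' \<noteq> b'" "\<epsilon> t' = \<epsilon> b'" "\<alpha> (\<epsilon> b') = b'"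
    by (auto simp: block_def)
  then show "p = (t, b)"
    using D by metis
qed

lemma corank1_tt_bb:
  assumes "corank1 \<epsilon> t b"
  shows "tt n \<alpha> \<epsilon> = t" "bb n \<alpha> \<epsilon> = b"
  using corank1_merged_pair [OF assms] stable_idem_vidempotent [OF corank1D(1) [OF assms]]
  by (simp_all add: tt_def bb_def)

lemma T_stable_iff:
  assumes "\<epsilon> \<in> vidempotents n \<alpha>" "card A \<ge> 2"
  shows "\<epsilon> \<in> T_stable n \<alpha> (card A - 1) \<longleftrightarrow> (\<exists>t b. corank1 \<epsilon> t b)"
  using assms ex_corank1 corank1_rank
  by (auto simp: T_stable_def stable_rank_def stable_idem_vidempotent vidempotents_iff)

lemma T_top_iff:
  assumes "\<epsilon> \<in> vidempotents n \<alpha>" "card A \<ge> 2"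
  shows "\<epsilon> \<in> T_top n (card A) \<alpha> a k \<longleftrightarrow> (\<exists>b. corank1 \<epsilon> (a k) b)"
  using T_stable_iff [OF assms] corank1_tt_bb by (fastforce simp: T_top_def)

lemma T_top_bot_iff:
  assumes "\<epsilon> \<in> vidempotents n \<alpha>" "card A \<ge> 2"
  shows "\<epsilon> \<in> T_top_bot n (card A) \<alpha> a k m \<longleftrightarrow> corank1 \<epsilon> (a k) (a m)"
  using T_top_iff [OF assms] corank1_tt_bb by (fastforce simp: T_top_bot_def)

section \<open>Kernel and image as coordinates of an idempotent\<close>

lemma kernel_eq_iff:
  "kernel n \<beta> = kernel n \<gamma> \<longleftrightarrow> (\<forall>x\<in>N. \<forall>y\<in>N. \<beta> x = \<beta> y \<longleftrightarrow> \<gamma> x = \<gamma> y)"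
proof
  have *: "\<beta> x = \<beta> y \<longleftrightarrow> (\<exists>B\<in>kernel n \<beta>. x \<in> B \<and> y \<in> B)" if "x \<in> N" "y \<in> N" for x y \<beta>
    using that by (auto simp: kernel_def quotient_def)
  show "kernel n \<beta> = kernel n \<gamma> \<Longrightarrow> \<forall>x\<in>N. \<forall>y\<in>N. \<beta> x = \<beta> y \<longleftrightarrow> \<gamma> x = \<gamma> y"
    using * by simp
  assume "\<forall>x\<in>N. \<forall>y\<in>N. \<beta> x = \<beta> y \<longleftrightarrow> \<gamma> x = \<gamma> y"
  then have "{(x, y). x \<in> N \<and> y \<in> N \<and> \<beta> x = \<beta> y} = {(x, y). x \<in> N \<and> y \<in> N \<and> \<gamma> x = \<gamma> y}"
    by blast
  then show "kernel n \<beta> = kernel n \<gamma>"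
    by (simp only: kernel_def)
qed

lemma corank1_kernel_eqI:
  assumes "corank1 \<beta> t b" "corank1 \<gamma> t' b'" "\<And>x. x \<in> N \<Longrightarrow> \<alpha> (\<beta> x) = \<alpha> (\<gamma> x)"
  shows "kernel n \<beta> = kernel n \<gamma>"
  unfolding kernel_eq_iff using assms corank1_eq_iff by metis

text \<open>As \<open>\<alpha>\<close> maps the image onto \<open>A - {t}\<close>, the image
  determines \<open>t\<close>. The kernel determines the \<open>c\<close> in \<open>A - {t}\<close>
  equivalent to \<open>x\<close>, and the only image point in the block of \<open>c\<close> is the
  value at \<open>x\<close>.\<close>

lemma corank1_eqI:
  assumes \<beta>: "corank1 \<beta> t b" and \<gamma>: "corank1 \<gamma> t' b'"
    and k: "kernel n \<beta> = kernel n \<gamma>" and i: "im n \<beta> = im n \<gamma>"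
  shows "\<beta> = \<gamma>"
proof -
  have aim: "\<alpha> ` im n \<delta> = A - {t}" if \<delta>: "corank1 \<delta> t b" for \<delta> t b
    using corank1D(6) [OF \<delta>] by (force simp: corank1_im [OF \<delta>] image_image)
  then have t: "t' = t"
    using \<beta> \<gamma> i corank1D(3) by (metis Diff_iff Diff_insert_absorb insert_Diff insert_iff)
  show ?thesis
  proof (rule trans_eqI)
    fix x assume x: "x \<in> N"
    define c where "c = \<alpha> (\<beta> x)"
    have c: "c \<in> A" "c \<noteq> t"
      using corank1_class [OF \<beta> x] by (simp_all add: c_def)
    have "\<beta> x = \<beta> c"
      using corank1D(9) [OF \<beta> x] by (simp add: c_def)
    moreover from this have "\<gamma> x = \<gamma> c"
      using k x A_N [OF c(1)] by (simp only: kernel_eq_iff)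
    moreover have "\<gamma> c \<in> im n \<beta>"
      using A_N [OF c(1)] by (simp only: i) (simp add: im_def)
    then obtain d where "d \<in> A" "d \<noteq> t" "\<gamma> c = \<beta> d"
      by (auto simp: corank1_im [OF \<beta>])
    then have "\<gamma> c = \<beta> c"
      using corank1D(6) [OF \<beta>, of d] corank1D(6) [OF \<gamma>, of c] c t by auto
    ultimately show "\<beta> x = \<gamma> x" by simp
  qed (use \<beta> \<gamma> corank1D(2) in auto)
qed

lemma corank1_im_in_V:
  assumes a: "bij_betw a {1..card A} A" and k: "k \<in> {1..card A}" and \<epsilon>: "corank1 \<epsilon> (a k) b"
  shows "im n \<epsilon> \<in> V n (card A) \<alpha> a k"
proof -
  have "a ` ({1..card A} - {k}) = A - {a k}"
    using a k by (auto simp: bij_betw_def inj_on_def)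
  then have im: "im n \<epsilon> = (\<epsilon> \<circ> a) ` ({1..card A} - {k})"
    by (simp only: corank1_im [OF \<epsilon>] image_comp [symmetric])
  have "\<forall>i\<in>{1..card A} - {k}. (\<epsilon> \<circ> a) i \<in> block n \<alpha> (a i)"
  proof
    fix i assume i: "i \<in> {1..card A} - {k}"
    then have "a i \<in> A" "a i \<noteq> a k"
      using a k by (auto simp: bij_betw_def inj_on_def)
    then show "(\<epsilon> \<circ> a) i \<in> block n \<alpha> (a i)"
      using corank1D(6) [OF \<epsilon>] trans_N [OF corank1D(2) [OF \<epsilon>]] A_N by (simp add: block_def)
  qed
  then show ?thesis
    using im unfolding V_def by blast
qed

lemma corank1_kernel_in_U:
  assumes \<epsilon>: "corank1 \<epsilon> (a k) (a m)"
  shows "kernel n \<epsilon> \<in> U n (card A) \<alpha> a k m"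
proof -
  let ?r = "{(x, y). x \<in> N \<and> y \<in> N \<and> \<epsilon> x = \<epsilon> y}"
  have cls: "?r `` {x} = {y \<in> N. \<epsilon> y = \<epsilon> x}" if "x \<in> N" for x
    using that by auto
  \<comment> \<open>Classes are indexed by their values: their number is then the rank, and each
    meets \<open>A\<close> because \<open>A - {t}\<close> already yields all values.\<close>
  have ker: "kernel n \<epsilon> = (\<lambda>v. {y \<in> N. \<epsilon> y = v}) ` im n \<epsilon>"
    unfolding kernel_def quotient_def im_def using cls by auto
  have part: "partition_on N (kernel n \<epsilon>)"
    unfolding ker im_def by (rule partition_onI) (auto simp: disjnt_iff)
  have "inj_on (\<lambda>v. {y \<in> N. \<epsilon> y = v}) (im n \<epsilon>)"
    unfolding im_def by (rule inj_onI) blast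
  then have card: "card (kernel n \<epsilon>) = card A - 1"
    using corank1_rank [OF \<epsilon>] by (simp only: ker card_image rank_def)
  have meet: "B \<inter> A \<noteq> {}" if "B \<in> kernel n \<epsilon>" for B
    using that A_N by (force simp: ker corank1_im [OF \<epsilon>])
  have "\<exists>B\<in>kernel n \<epsilon>. a k \<in> B \<and> a m \<in> B"
    using corank1D(3,4,7) [OF \<epsilon>] A_N by (force simp: ker im_def)
  with part card meet show ?thesis
    by (simp add: U_def)
qed

text \<open>The labels reached by \<open>e\<close> form \<open>A - {t}\<close>. There
  \<open>f\<close> is injective and has the same values as on \<open>A - {t'}\<close>: if
  \<open>t\<close> and \<open>t'\<close> differ, the two sets differ only by exchanging
  \<open>t'\<close> and \<open>b'\<close>, which \<open>f\<close> merges.\<close>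

lemma corank1_vmult:
  assumes e: "corank1 e t b" and f: "corank1 f t' b'"
    and tb: "t = t' \<or> t = b' \<and> t' = b"
  shows "e \<star> f \<in> vidempotents n \<alpha>" "kernel n (e \<star> f) = kernel n e" "im n (e \<star> f) = im n f"
proof -
  note De = corank1D [OF e] and Df = corank1D [OF f]
  \<comment> \<open>In the exchanged case \<open>f\<close> takes \<open>t'\<close> to the block of
    \<open>b' = t\<close>, and \<open>e\<close> takes \<open>t\<close> back to the block of
    \<open>b = t'\<close>. Otherwise both keep the block of \<open>c\<close>.\<close>
  have step: "f (\<alpha> (e (\<alpha> (f c)))) = f c" if c: "c \<in> A" "c \<noteq> t" for c
  proof (cases "c = t'")
    case True
    then have "t = b'" "t' = b"
      using tb c by auto
    then show ?thesis
      using True De(8) Df(8) by simp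
  qed (simp add: De(6) Df(6) c)
  have inj: "inj_on f (A - {t})"
  proof (cases "t = t'")
    case True
    then show ?thesis using corank1_inj [OF f] by simp
  next
    case False
    then have "A - {t} = insert t' (A - {t', b'})" "A - {t'} = insert b' (A - {t', b'})"
      using tb Df(3-5) by auto
    then show ?thesis
      using corank1_inj [OF f] Df(7) by simp
  qed
  have "(e \<star> f) (\<alpha> ((e \<star> f) x)) = (e \<star> f) x" if x: "x \<in> N" for x
  proof -
    have c: "\<alpha> (e x) \<in> A" "\<alpha> (e x) \<noteq> t"
      using corank1_class [OF e x] by auto
    then have "\<alpha> (f (\<alpha> (e x))) \<in> N"
      using A_N trans_N [OF Df(2)] \<alpha>_N by blast
    then show ?thesis
      using x step [OF c] by (simp add: vmult_apply)
  qed
  then show "e \<star> f \<in> vidempotents n \<alpha>"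
    using vmult_closed [OF De(2) Df(2)] by (simp add: vidempotents_iff)
  have "(e \<star> f) x = (e \<star> f) y \<longleftrightarrow> e x = e y" if xy: "x \<in> N" "y \<in> N" for x y
    using inj corank1_class [OF e xy(1)] corank1_class [OF e xy(2)] corank1_eq_iff [OF e xy]
    by (simp add: vmult_apply xy inj_on_eq_iff)
  then show "kernel n (e \<star> f) = kernel n e"
    by (simp only: kernel_eq_iff) blast
  have "im n (e \<star> f) = f ` (\<lambda>x. \<alpha> (e x)) ` N"
    unfolding im_def image_image by (intro image_cong refl vmult_apply)
  also have "(\<lambda>x. \<alpha> (e x)) ` N = A - {t}"
  proof
    show "A - {t} \<subseteq> (\<lambda>x. \<alpha> (e x)) ` N"
    proof
      fix c assume "c \<in> A - {t}"
      then have "\<alpha> (e c) = c" "c \<in> N"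
        using De(6) A_N by auto
      then show "c \<in> (\<lambda>x. \<alpha> (e x)) ` N"
        by (intro image_eqI [of _ _ c]) auto
    qed
  qed (use corank1_class [OF e] in auto)
  also have "f ` (A - {t}) = f ` (A - {t'})"
  proof (cases "t = t'")
    case False
    then have "A - {t} = insert t' (A - {t', b'})" "A - {t'} = insert b' (A - {t', b'})"
      using tb Df(3-5) by auto
    then show ?thesis
      using Df(7) by simp
  qed simp
  finally show "im n (e \<star> f) = im n f"
    by (simp only: corank1_im [OF f])
qed

end


section \<open>Isolated subsemigroups of stable corank one\<close>

locale isolated_corank1 = variant_semigroup +
  fixes T :: "(nat \<Rightarrow> nat) set"
  assumes isolated: "isolated_subsemigroup (trans_maps n) (vmult n \<alpha>) T"
    and T_stable: "T \<subseteq> T_stable n \<alpha> (card A - 1)"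
    and card_A: "card A \<ge> 2"
begin

section \<open>The idempotents of T form a rectangular band\<close>

definition E where "E = T \<inter> vidempotents n \<alpha>"

lemma T_sub: "subsemigroup (trans_maps n) (vmult n \<alpha>) T"
  using isolated by (simp add: isolated_subsemigroup_def)

lemma T_trans: "\<beta> \<in> T \<Longrightarrow> \<beta> \<in> trans_maps n"
  using T_sub by (auto simp: subsemigroup_def)

lemma T_vmult: "\<beta> \<in> T \<Longrightarrow> \<gamma> \<in> T \<Longrightarrow> \<beta> \<star> \<gamma> \<in> T"
  using T_sub by (simp add: subsemigroup_def)

lemma T_root: "\<beta> \<in> trans_maps n \<Longrightarrow> j > 0 \<Longrightarrow> spow (vmult n \<alpha>) \<beta> j \<in> T \<Longrightarrow> \<beta> \<in> T"
  using isolated unfolding isolated_subsemigroup_def by blast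

lemma T_sqrt: "\<beta> \<in> trans_maps n \<Longrightarrow> \<beta> \<star> \<beta> \<in> T \<Longrightarrow> \<beta> \<in> T"
  using T_root [of \<beta> 2] by (simp add: spow_2)

lemma ex_spow_E:
  assumes "\<beta> \<in> T"
  shows "\<exists>j>0. spow (vmult n \<alpha>) \<beta> j \<in> E"
proof -
  obtain j where "j > 0" "spow (vmult n \<alpha>) \<beta> j \<in> vidempotents n \<alpha>"
    using ex_idempotent_spow [OF T_trans [OF assms]] by (auto simp: vidempotents_def)
  moreover have "spow (vmult n \<alpha>) \<beta> j \<in> T"
    using spow_mem [OF T_sub assms \<open>j > 0\<close>] .
  ultimately show ?thesis by (auto simp: E_def)
qed

lemma E_nonempty: "E \<noteq> {}"
proof -
  obtain \<beta> where "\<beta> \<in> T"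
    using T_sub by (auto simp: subsemigroup_def)
  then show ?thesis using ex_spow_E by blast
qed

text \<open>Every element of \<open>T\<close> has an idempotent power, which stays in
  \<open>T\<close>; isolation gives the converse. So \<open>T\<close> is known once \<open>E\<close>
  is.\<close>

lemma T_eq_roots: "T = (\<Union>\<epsilon>\<in>E. vroot n \<alpha> \<epsilon>)"
proof
  show "T \<subseteq> (\<Union>\<epsilon>\<in>E. vroot n \<alpha> \<epsilon>)"
    using ex_spow_E T_trans unfolding vroot_def by blast
  show "(\<Union>\<epsilon>\<in>E. vroot n \<alpha> \<epsilon>) \<subseteq> T"
    using T_root unfolding vroot_def E_def by blast
qed

lemma E_corank1: "e \<in> E \<Longrightarrow> \<exists>t b. corank1 e t b"
  using T_stable T_stable_iff [OF _ card_A] unfolding E_def by blast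

text \<open>Otherwise \<open>t'\<close> and \<open>b'\<close> both lie in \<open>A - {t}\<close>,
  where \<open>f\<close> merges them. Then all powers of \<open>e \<star> f\<close> have rank below
  \<open>card A - 1\<close>, although one of them belongs to \<open>E\<close>.\<close>

lemma E_merge:
  assumes "e \<in> E" "f \<in> E" and e: "corank1 e t b" and f: "corank1 f t' b'"
  shows "t = t' \<or> t = b'"
proof (rule ccontr)
  assume ne: "\<not> (t = t' \<or> t = b')"
  have tr: "e \<in> trans_maps n" "f \<in> trans_maps n"
    using e f corank1D(2) by auto
  have "e \<star> f \<in> T"
    using assms by (simp add: E_def T_vmult)
  then obtain j where j: "j > 0" "spow (vmult n \<alpha>) (e \<star> f) j \<in> E"
    using ex_spow_E by blast
  define h where "h = spow (vmult n \<alpha>) (e \<star> f) j"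
  have ef: "(e \<star> f) x \<in> f ` (A - {t})" if "x \<in> N" for x
    using corank1_class [OF e that] by (simp add: vmult_apply that)
  \<comment> \<open>The last factor of each power is \<open>e \<star> f\<close>, so its values
    remain values of \<open>f\<close> on \<open>A - {t}\<close>.\<close>
  have "h x \<in> f ` (A - {t})" if x: "x \<in> N" for x
  proof (cases "j = 1")
    case True
    then show ?thesis using ef x by (simp add: h_def One_nat_def)
  next
    case False
    then obtain i where i: "j = Suc i" "i > 0"
      using j(1) by (cases j) (auto simp: One_nat_def)
    have "\<alpha> (spow (vmult n \<alpha>) (e \<star> f) i x) \<in> N"
      by (rule \<alpha>_N, rule trans_N [OF spow_closed [OF vmult_closed [OF tr] i(2)] x])
    then show ?thesis
      using ef i x by (simp add: h_def spow_Suc vmult_apply [of _ _ "e \<star> f"])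
  qed
  then have "im n h \<subseteq> f ` (A - {t})"
    by (auto simp: im_def)
  then have "rank n h \<le> card (f ` (A - {t}))"
    unfolding rank_def using fin_A by (intro card_mono) auto
  moreover have "rank n h = card (A - {t})"
    using E_corank1 j(2) corank1_rank corank1D(3) [OF e] fin_A by (fastforce simp: h_def)
  ultimately have "inj_on f (A - {t})"
    using fin_A by (intro eq_card_imp_inj_on) (auto intro: antisym card_image_le)
  then show False
    using ne corank1D(3,4,5,7) [OF f] by (auto dest: inj_onD)
qed

lemma E_compatible:
  assumes "e \<in> E" "f \<in> E" "corank1 e t b" "corank1 f t' b'"
  shows "t = t' \<or> t = b' \<and> t' = b"
  using E_merge [OF assms] E_merge [OF assms(2,1,4,3)] by blast

lemma E_vmult:
  assumes "e \<in> E" "f \<in> E"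
  shows "e \<star> f \<in> E" "kernel n (e \<star> f) = kernel n e" "im n (e \<star> f) = im n f"
proof -
  obtain t b t' b' where *: "corank1 e t b" "corank1 f t' b'"
    using assms E_corank1 by blast
  note tb = E_compatible [OF assms *]
  show "kernel n (e \<star> f) = kernel n e" "im n (e \<star> f) = im n f"
    by (rule corank1_vmult [OF * tb])+
  show "e \<star> f \<in> E"
    using corank1_vmult(1) [OF * tb] T_vmult assms by (simp add: E_def)
qed

text \<open>The idempotents of \<open>T\<close> form a rectangular band with coordinates kernel and image.\<close>

lemma E_rectangle:
  assumes "e \<in> E" "f \<in> E" "corank1 \<epsilon> t b" "kernel n \<epsilon> = kernel n e" "im n \<epsilon> = im n f"
  shows "\<epsilon> \<in> E"
proof -
  obtain t' b' where "corank1 (e \<star> f) t' b'"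
    using E_corank1 [OF E_vmult(1) [OF assms(1,2)]] by blast
  then have "\<epsilon> = e \<star> f"
    using corank1_eqI [OF assms(3)] E_vmult [OF assms(1,2)] assms(4,5) by simp
  then show ?thesis using E_vmult(1) [OF assms(1,2)] by simp
qed

section \<open>Moving one image point within its block\<close>

text \<open>Since \<open>c\<close> and \<open>h s\<close> lie in the same block, the value \<open>\<beta> k = c\<close> does not affect \<open>\<beta> \<star> \<beta>\<close>,
  but \<open>f\<close> brings it to light, as it sends \<open>m\<close> to the block of \<open>k\<close>.\<close>

lemma ex_E_update_image:
  assumes hE: "h \<in> E" and h: "corank1 h k m" and fE: "f \<in> E" and f: "corank1 f m k"
    and s: "s \<in> A" "s \<noteq> k" and c: "c \<in> N" "\<alpha> c = s"
  shows "\<exists>h'\<in>E. corank1 h' k m \<and> (\<forall>x\<in>A - {k, s}. h' x = h x) \<and> h' s = c"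
proof -
  note Dh = corank1D [OF h] and Df = corank1D [OF f]
  \<comment> \<open>\<open>f\<close> changes only the label \<open>m\<close>, so the class labelled
    \<open>s\<close> has to be routed through \<open>m\<close>.\<close>
  define \<sigma> where "\<sigma> = transpose s m"
  have \<sigma>: "\<sigma> x \<in> A" "\<sigma> x \<noteq> k" "\<sigma> (\<sigma> x) = x" if "x \<in> A" "x \<noteq> k" for x
    using that s Dh(3-5) by (auto simp: \<sigma>_def transpose_def)
  have \<sigma>m: "\<sigma> x = m \<longleftrightarrow> x = s" for x
    by (auto simp: \<sigma>_def transpose_def)
  \<comment> \<open>Off \<open>k\<close> this is \<open>h\<close> with its labels permuted by the
    involution \<open>\<sigma>\<close>, which cancels in \<open>\<beta> \<star> \<beta>\<close>. At
    \<open>k\<close> the same formula would give \<open>h s\<close>.\<close>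
  define \<beta> where "\<beta> = (\<lambda>x\<in>N. if x = k then c else h (\<sigma> (\<alpha> (h x))))"
  note cls = corank1_class [OF h]
  have \<beta>T: "\<beta> \<in> trans_maps n"
    using c cls \<sigma> A_N trans_N [OF Dh(2)] by (auto simp: \<beta>_def trans_maps_def)
  have \<alpha>\<beta>: "\<alpha> (\<beta> x) = \<sigma> (\<alpha> (h x))" if "x \<in> N" for x
    using that cls [OF that] \<sigma> Dh(6,8) c by (simp add: \<beta>_def \<sigma>_def)
  have \<beta>A: "\<beta> x = h (\<sigma> x)" if "x \<in> A" "x \<noteq> k" for x
    using that A_N Dh(6) by (simp add: \<beta>_def)
  have \<beta>k: "\<beta> k = c"
    using A_N Dh(3) by (simp add: \<beta>_def)
  have "\<beta> \<star> \<beta> = h"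
    using cls \<sigma> Dh(9)
    by (intro trans_eqI vmult_closed \<beta>T Dh(2)) (simp add: vmult_apply \<alpha>\<beta> \<beta>A)
  then have "\<beta> \<in> T"
    using T_sqrt \<beta>T hE by (simp add: E_def)
  \<comment> \<open>On the class labelled \<open>s\<close>, the first \<open>\<beta>\<close> leads
    to \<open>m\<close>, \<open>f\<close> to \<open>k\<close>, and the second \<open>\<beta>\<close>
    to \<open>c\<close>. Any other label is fixed by \<open>f\<close> and restored by the second
    \<open>\<beta>\<close>.\<close>
  define h' where "h' = \<beta> \<star> f \<star> \<beta>"
  have h'T: "h' \<in> T"
    using \<open>\<beta> \<in> T\<close> fE by (simp add: h'_def E_def T_vmult)
  have h': "h' x = (if \<alpha> (h x) = s then c else h x)" if x: "x \<in> N" for x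
  proof (cases "\<alpha> (h x) = s")
    case True
    then have "\<alpha> (\<beta> x) = m"
      using \<alpha>\<beta> x \<sigma>m by simp
    then show ?thesis
      using True x Df(8) \<beta>k by (simp add: h'_def vmult_apply)
  next
    case False
    then have "\<sigma> (\<alpha> (h x)) \<noteq> m"
      using \<sigma>m by simp
    then have "\<alpha> (f (\<alpha> (\<beta> x))) = \<sigma> (\<alpha> (h x))"
      using Df(6) \<alpha>\<beta> x \<sigma> cls [OF x] by simp
    then show ?thesis
      using False x \<beta>A \<sigma> cls [OF x] Dh(9) by (simp add: h'_def vmult_apply)
  qed
  have \<alpha>h': "\<alpha> (h' x) = \<alpha> (h x)" if "x \<in> N" for x
    using h' that c by simp
  have "h' \<in> vidempotents n \<alpha>"
    unfolding vidempotents_iff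
    using T_trans [OF h'T] \<alpha>h' h' Dh(9) A_N cls by simp
  then have "h' \<in> E" "corank1 h' k m"
    using h'T h' \<alpha>h' Dh A_N c by (simp_all add: E_def corank1_def)
  moreover have "\<forall>x\<in>A - {k, s}. h' x = h x" "h' s = c"
    using h' Dh(6) A_N s by auto
  ultimately show ?thesis by blast
qed

lemma ex_E_image:
  assumes hE: "h \<in> E" and h: "corank1 h k m" and fE: "f \<in> E" and f: "corank1 f m k"
    and \<epsilon>: "corank1 \<epsilon> k b"
  shows "\<exists>g\<in>E. im n \<epsilon> = im n g"
proof -
  have *: "\<exists>g\<in>E. corank1 g k m \<and> (\<forall>x\<in>S. g x = \<epsilon> x)" if "finite S" "S \<subseteq> A - {k}" for S
    using that
  proof induction
    case empty
    then show ?case using hE h by auto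
  next
    case (insert s S)
    then obtain g where g: "g \<in> E" "corank1 g k m" "\<forall>x\<in>S. g x = \<epsilon> x"
      by auto
    have s: "s \<in> A" "s \<noteq> k"
      using insert by auto
    obtain g' where g': "g' \<in> E" "corank1 g' k m" "\<forall>x\<in>A - {k, s}. g' x = g x" "g' s = \<epsilon> s"
      using ex_E_update_image [OF g(1,2) fE f s, of "\<epsilon> s"] s corank1D(2,6) [OF \<epsilon>] trans_N A_N
      by blast
    have "x \<in> A - {k, s}" if "x \<in> S" for x
      using that insert.hyps insert.prems by auto
    then have "\<forall>x\<in>insert s S. g' x = \<epsilon> x"
      using g(3) g'(3,4) by simp
    then show ?case
      using g' by blast
  qed
  obtain g where "g \<in> E" "corank1 g k m" "\<forall>x\<in>A - {k}. g x = \<epsilon> x"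
    using * [of "A - {k}"] fin_A by auto
  then show ?thesis
    using corank1_im [OF \<epsilon>] corank1_im by (metis image_cong)
qed

section \<open>Moving one point to another kernel class\<close>

text \<open>Sending \<open>s\<close> to the block of \<open>k\<close> rather than of \<open>m\<close> does not affect \<open>\<beta> \<star> \<beta>\<close>, because \<open>h\<close> merges
  \<open>k\<close> and \<open>m\<close>; but \<open>f\<close> merges \<open>k\<close> and \<open>m'\<close>. The last assumption lets \<open>\<sigma>\<close> be an involution
  with \<open>\<alpha> (h s) \<mapsto> m\<close> and \<open>j \<mapsto> m'\<close>.\<close>

lemma ex_E_update_class_aux:
  assumes hE: "h \<in> E" and h: "corank1 h k m" and fE: "f \<in> E" and f: "corank1 f k m'"
    and "m \<noteq> m'" and s: "s \<in> N" "s \<notin> A" and j: "j \<in> A" "j \<noteq> k"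
    and ij: "\<alpha> (h s) = m' \<and> j = m \<or> \<alpha> (h s) \<noteq> m' \<and> j \<noteq> m"
  shows "\<exists>h'\<in>E. corank1 h' k m \<and> (\<forall>x\<in>N. \<alpha> (h' x) = (if x = s then j else \<alpha> (h x)))"
proof (cases "\<alpha> (h s) = j")
  case True
  then show ?thesis using hE h by auto
next
  case False
  define i where "i = \<alpha> (h s)"
  note Dh = corank1D [OF h] and Df = corank1D [OF f]
  note cls = corank1_class [OF h]
  have i: "i \<in> A" "i \<noteq> k" "i \<noteq> j"
    using cls s False by (auto simp: i_def)
  have "\<exists>\<sigma>. (\<forall>x\<in>A - {k}. \<sigma> x \<in> A - {k} \<and> \<sigma> (\<sigma> x) = x) \<and> \<sigma> i = m \<and> \<sigma> j = m'"
  proof (cases "i = m'")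
    case True
    with ij i_def have "j = m" by simp
    then show ?thesis
      using True Dh(3-5) Df(3-5) by (intro exI [of _ "transpose m m'"]) (auto simp: transpose_def)
  next
    case False
    with ij i_def have "j \<noteq> m" by simp
    \<comment> \<open>The swaps of \<open>i\<close> with \<open>m\<close> and of \<open>j\<close>
      with \<open>m'\<close>. In this case \<open>{i, m}\<close> and \<open>{j, m'}\<close> are
      disjoint, though either may be a single point.\<close>
    define \<sigma> where "\<sigma> x = (if x = i then m else if x = m then i
      else if x = j then m' else if x = m' then j else x)" for x
    have \<sigma>_in: "\<sigma> x \<in> A - {k}" if "x \<in> A - {k}" for x
      using that i j Dh(4,5) Df(4,5) unfolding \<sigma>_def by simp
    have "\<sigma> (\<sigma> x) = x" for x
      using False \<open>j \<noteq> m\<close> i(3) \<open>m \<noteq> m'\<close> unfolding \<sigma>_def by (simp split: if_split)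
    moreover have "\<sigma> i = m" "\<sigma> j = m'"
      using False \<open>j \<noteq> m\<close> i(3) by (simp_all add: \<sigma>_def)
    ultimately show ?thesis
      using \<sigma>_in by blast
  qed
  then obtain \<sigma> where \<sigma>: "\<And>x. x \<in> A \<Longrightarrow> x \<noteq> k \<Longrightarrow> \<sigma> x \<in> A \<and> \<sigma> x \<noteq> k \<and> \<sigma> (\<sigma> x) = x"
    and \<sigma>i: "\<sigma> i = m" and \<sigma>j: "\<sigma> j = m'"
    by auto
  have \<sigma>m: "\<sigma> m = i" "\<sigma> m' = j"
    using \<sigma> i j \<sigma>i \<sigma>j by metis+
  \<comment> \<open>As \<open>s\<close> is not in \<open>A\<close>, its value does not disturb
    \<open>\<beta>\<close> on \<open>A\<close>. The permuted \<open>h\<close> would send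
    \<open>s\<close> to the label \<open>m\<close>; \<open>k\<close> replaces it, and
    \<open>\<beta> k = \<beta> m = h i\<close>.\<close>
  define \<beta> where "\<beta> = (\<lambda>x\<in>N. if x = s then k else h (\<sigma> (\<alpha> (h x))))"
  have \<beta>T: "\<beta> \<in> trans_maps n"
    using Dh(3) cls \<sigma> A_N trans_N [OF Dh(2)] by (auto simp: \<beta>_def trans_maps_def)
  have \<alpha>\<beta>: "\<alpha> (\<beta> x) = (if x = s then k else \<sigma> (\<alpha> (h x)))" if "x \<in> N" for x
    using that cls [OF that] \<sigma> Dh(3,6) \<alpha>_id by (simp add: \<beta>_def)
  have \<beta>A: "\<beta> x = h (\<sigma> x)" if "x \<in> A" "x \<noteq> k" for x
    using that A_N Dh(6) s by (auto simp: \<beta>_def)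
  have \<beta>k: "\<beta> k = h i"
    using A_N Dh(3,8) s \<sigma>m by (auto simp: \<beta>_def)
  have "\<beta> \<star> \<beta> = h"
    using cls \<sigma> Dh(9) s(1)
    by (intro trans_eqI vmult_closed \<beta>T Dh(2)) (simp add: vmult_apply \<alpha>\<beta> \<beta>A \<beta>k i_def)
  then have "\<beta> \<in> T"
    using T_sqrt \<beta>T hE by (simp add: E_def)
  \<comment> \<open>\<open>f\<close> sends \<open>k\<close>, the value of \<open>\<beta>\<close> at
    \<open>s\<close>, to the label \<open>m'\<close>, which the second \<open>\<beta>\<close> turns
    into \<open>h j\<close>. All other labels pass through \<open>f\<close> unchanged.\<close>
  define h' where "h' = \<beta> \<star> f \<star> \<beta>"
  have h'T: "h' \<in> T"
    using \<open>\<beta> \<in> T\<close> fE by (simp add: h'_def E_def T_vmult)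
  have h': "h' x = (if x = s then h j else h x)" if x: "x \<in> N" for x
  proof (cases "x = s")
    case True
    then show ?thesis
      using x \<alpha>\<beta> Df(4,5,8) \<beta>A \<sigma>m by (simp add: h'_def vmult_apply)
  next
    case False
    then have "\<alpha> (f (\<alpha> (\<beta> x))) = \<sigma> (\<alpha> (h x))"
      using Df(6) \<alpha>\<beta> x \<sigma> cls [OF x] by simp
    then show ?thesis
      using False x \<beta>A \<sigma> cls [OF x] Dh(9) by (simp add: h'_def vmult_apply)
  qed
  have h'A: "h' x = h x" if "x \<in> A" for x
    using that h' A_N s by auto
  have "h' \<in> vidempotents n \<alpha>"
    unfolding vidempotents_iff
    using T_trans [OF h'T] h' h'A Dh(6,9) A_N cls j by simp
  then have "h' \<in> E" "corank1 h' k m"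
    using h'T h'A Dh by (simp_all add: E_def corank1_def)
  moreover have "\<forall>x\<in>N. \<alpha> (h' x) = (if x = s then j else \<alpha> (h x))"
    using h' Dh(6) j by simp
  ultimately show ?thesis by blast
qed

text \<open>When the condition \<open>ij\<close> of the auxiliary lemma fails, a detour through an
  intermediate class \<open>i\<close> works: the condition holds for both of the two moves.\<close>

lemma ex_E_update_class:
  assumes hE: "h \<in> E" and h: "corank1 h k m" and fE: "f \<in> E" and f: "corank1 f k m'"
    and "m \<noteq> m'" and s: "s \<in> N" "s \<notin> A" and j: "j \<in> A" "j \<noteq> k"
  shows "\<exists>h'\<in>E. corank1 h' k m \<and> (\<forall>x\<in>N. \<alpha> (h' x) = (if x = s then j else \<alpha> (h x)))"
proof (cases "\<alpha> (h s) = m' \<and> j = m \<or> \<alpha> (h s) \<noteq> m' \<and> j \<noteq> m")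
  case True
  then show ?thesis
    using ex_E_update_class_aux assms by blast
next
  case False
  define i where "i = (if j = m then m' else m)"
  have i: "i \<in> A" "i \<noteq> k"
    using corank1D(4,5) [OF h] corank1D(4,5) [OF f] by (auto simp: i_def)
  have "\<alpha> (h s) = m' \<and> i = m \<or> \<alpha> (h s) \<noteq> m' \<and> i \<noteq> m"
    using False \<open>m \<noteq> m'\<close> by (auto simp: i_def)
  then obtain g where g: "g \<in> E" "corank1 g k m"
      "\<forall>x\<in>N. \<alpha> (g x) = (if x = s then i else \<alpha> (h x))"
    using ex_E_update_class_aux [OF hE h fE f \<open>m \<noteq> m'\<close> s i] by blast
  have "\<alpha> (g s) = m' \<and> j = m \<or> \<alpha> (g s) \<noteq> m' \<and> j \<noteq> m"
    using g(3) s \<open>m \<noteq> m'\<close> by (auto simp: i_def)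
  then obtain h' where "h' \<in> E" "corank1 h' k m"
      "\<forall>x\<in>N. \<alpha> (h' x) = (if x = s then j else \<alpha> (g x))"
    using ex_E_update_class_aux [OF g(1,2) fE f \<open>m \<noteq> m'\<close> s j] by blast
  then show ?thesis
    using g(3) by (intro bexI [of _ h']) auto
qed

text \<open>On \<open>A\<close> the labels are already prescribed by \<open>k\<close> and
  \<open>m\<close>, so only the points outside \<open>A\<close> can differ from those of
  \<open>\<epsilon>\<close>. They are adjusted one at a time, starting from
  \<open>h\<close>.\<close>

lemma ex_E_kernel:
  assumes hE: "h \<in> E" and h: "corank1 h k m" and fE: "f \<in> E" and f: "corank1 f k m'"
    and "m \<noteq> m'" and \<epsilon>: "corank1 \<epsilon> k m"
  shows "\<exists>g\<in>E. kernel n \<epsilon> = kernel n g"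
proof -
  have *: "\<exists>g\<in>E. corank1 g k m \<and> (\<forall>x\<in>S. \<alpha> (g x) = \<alpha> (\<epsilon> x))" if "finite S" "S \<subseteq> N - A" for S
    using that
  proof induction
    case empty
    then show ?case using hE h by auto
  next
    case (insert s S)
    then obtain g where g: "g \<in> E" "corank1 g k m" "\<forall>x\<in>S. \<alpha> (g x) = \<alpha> (\<epsilon> x)"
      by auto
    have s: "s \<in> N" "s \<notin> A"
      using insert by auto
    obtain g' where g': "g' \<in> E" "corank1 g' k m"
        "\<forall>x\<in>N. \<alpha> (g' x) = (if x = s then \<alpha> (\<epsilon> s) else \<alpha> (g x))"
      using ex_E_update_class [OF g(1,2) fE f \<open>m \<noteq> m'\<close> s corank1_class [OF \<epsilon> s(1)]] by blast
    have "\<forall>x\<in>insert s S. \<alpha> (g' x) = \<alpha> (\<epsilon> x)"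
      using g(3) g'(3) insert.prems by auto
    then show ?case
      using g' by blast
  qed
  obtain g where g: "g \<in> E" "corank1 g k m" "\<forall>x\<in>N - A. \<alpha> (g x) = \<alpha> (\<epsilon> x)"
    using * [of "N - A"] by auto
  have "\<alpha> (\<epsilon> x) = \<alpha> (g x)" if "x \<in> N" for x
    using that g(3) corank1D(6,8) [OF \<epsilon>] corank1D(6,8) [OF g(2)] by (metis DiffI)
  then show ?thesis
    using corank1_kernel_eqI [OF \<epsilon> g(2)] g(1) by blast
qed

section \<open>The three families\<close>

theorem isolated_corank1_classification:
  assumes a: "bij_betw a {1..card A} A"
  shows "(\<exists>k\<in>{1..card A}. \<exists>m\<in>{1..card A}. \<exists>X Y. k \<noteq> m \<and>
            X \<noteq> {} \<and> X \<subseteq> U n (card A) \<alpha> a k m \<and> Y \<noteq> {} \<and> Y \<subseteq> V n (card A) \<alpha> a k \<and>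
            T = H n (card A) \<alpha> a k m X Y)
       \<or> (\<exists>k\<in>{1..card A}. \<exists>m\<in>{1..card A}. \<exists>X. k \<noteq> m \<and>
            X \<noteq> {} \<and> X \<subseteq> U n (card A) \<alpha> a k m \<and>
            T = K n (card A) \<alpha> a k m X)
       \<or> (\<exists>k\<in>{1..card A}. \<exists>M Y. M \<subseteq> a ` ({1..card A} - {k}) \<and> card M > 1 \<and>
            Y \<noteq> {} \<and> Y \<subseteq> V n (card A) \<alpha> a k \<and>
            T = L n (card A) \<alpha> a k M Y)"
    (is "?H \<or> ?K \<or> ?L")
proof -
  have ex_index: "\<exists>i\<in>{1..card A}. c = a i" if "c \<in> A" for c
    using that a by (auto simp: bij_betw_def)
  \<comment> \<open>\<open>H\<close>, \<open>K\<close> and \<open>L\<close> are unions of roots over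
    the idempotents with some property \<open>P\<close>, so it is enough that \<open>P\<close> cuts
    out \<open>E\<close>.\<close>
  have T_eqI: "T = (\<Union>\<epsilon>\<in>{\<epsilon> \<in> vidempotents n \<alpha>. P \<epsilon>}. vroot n \<alpha> \<epsilon>)"
    if "\<And>\<epsilon>. \<epsilon> \<in> E \<Longrightarrow> P \<epsilon>" "\<And>\<epsilon>. \<epsilon> \<in> vidempotents n \<alpha> \<Longrightarrow> P \<epsilon> \<Longrightarrow> \<epsilon> \<in> E" for P
  proof -
    have "{\<epsilon> \<in> vidempotents n \<alpha>. P \<epsilon>} = E"
      using that by (auto simp: E_def)
    then show ?thesis using T_eq_roots by simp
  qed
  have vid: "\<epsilon> \<in> vidempotents n \<alpha>" if "\<epsilon> \<in> E" for \<epsilon>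
    using that by (simp add: E_def)
  note top = T_top_iff [OF _ card_A] and top_bot = T_top_bot_iff [OF _ card_A]
  obtain e t b where e: "e \<in> E" "corank1 e t b"
    using E_nonempty E_corank1 by blast
  obtain k m where k: "k \<in> {1..card A}" "t = a k" and m: "m \<in> {1..card A}" "b = a m"
    using ex_index corank1D(3,4) [OF e(2)] by metis
  have ne: "kernel n ` E \<noteq> {}" "im n ` E \<noteq> {}"
    using E_nonempty by auto
  have km: "k \<noteq> m"
    using corank1D(5) [OF e(2)] k m by auto
  show ?thesis
  proof (cases "\<exists>f\<in>E. \<exists>t' b'. corank1 f t' b' \<and> t' \<noteq> t")
    case True
    then obtain f t' b' where "f \<in> E" "corank1 f t' b'" "t' \<noteq> t"
      by blast
    \<comment> \<open>Since \<open>t'\<close> differs from \<open>t\<close>, compatibility leaves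
      only the reversed pair.\<close>
    with E_compatible [OF e(1) _ e(2)] have f: "f \<in> E" "corank1 f b t"
      by blast+
    \<comment> \<open>Compatibility with both \<open>e\<close> and \<open>f\<close> excludes any
      third pair.\<close>
    have E_cases: "corank1 g t b \<or> corank1 g b t" if g: "g \<in> E" for g
    proof -
      obtain t' b' where g': "corank1 g t' b'"
        using E_corank1 [OF g] by blast
      show ?thesis
        using E_compatible [OF e(1) g e(2) g'] E_compatible [OF f(1) g f(2) g'] g'
          corank1D(5) [OF e(2)] by blast
    qed
    have "kernel n g \<in> U n (card A) \<alpha> a k m" if g: "g \<in> E" for g
    proof -
      have "U n (card A) \<alpha> a m k = U n (card A) \<alpha> a k m"
        unfolding U_def by blast
      then show ?thesis
        using E_cases [OF g] corank1_kernel_in_U k m by metis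
    qed
    then have X: "kernel n ` E \<subseteq> U n (card A) \<alpha> a k m"
      by blast
    have TK: "T = K n (card A) \<alpha> a k m (kernel n ` E)"
      unfolding K_def
    proof (rule T_eqI)
      fix \<epsilon> assume "\<epsilon> \<in> E"
      then show "\<epsilon> \<in> T_top_bot n (card A) \<alpha> a k m \<union> T_top_bot n (card A) \<alpha> a m k \<and>
          kernel n \<epsilon> \<in> kernel n ` E"
        using E_cases k m vid by (simp add: top_bot)
    next
      fix \<epsilon> assume \<epsilon>: "\<epsilon> \<in> vidempotents n \<alpha>"
        and "\<epsilon> \<in> T_top_bot n (card A) \<alpha> a k m \<union> T_top_bot n (card A) \<alpha> a m k \<and>
          kernel n \<epsilon> \<in> kernel n ` E"
      then obtain g where g: "g \<in> E" "kernel n \<epsilon> = kernel n g"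
        and tb: "corank1 \<epsilon> t b \<or> corank1 \<epsilon> b t"
        using k m by (auto simp: top_bot)
      \<comment> \<open>Both orders of the pair occur in \<open>E\<close>, so the image of
        \<open>\<epsilon>\<close> occurs as well, whichever order \<open>\<epsilon>\<close>
        has.\<close>
      from tb obtain h where h: "h \<in> E" "im n \<epsilon> = im n h"
        using ex_E_image [OF e f] ex_E_image [OF f e] by blast
      from tb show "\<epsilon> \<in> E"
        using E_rectangle [OF g(1) h(1) _ g(2) h(2)] by blast
    qed
    have ?K
    proof (rule bexI [OF _ k(1)], rule bexI [OF _ m(1)], intro exI [of _ "kernel n ` E"] conjI)
    qed (fact km ne(1) X TK)+
    then show ?thesis by blast
  next
    case False
    then have E_top: "\<exists>b. corank1 g (a k) b" if "g \<in> E" for g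
      using that E_corank1 k by blast
    have Y: "im n ` E \<subseteq> V n (card A) \<alpha> a k"
      using E_top corank1_im_in_V [OF a k(1)] by blast
    define M where "M = bb n \<alpha> ` E"
    have M: "M \<subseteq> A - {a k}"
      using E_top corank1D(4,5) corank1_tt_bb(2) unfolding M_def by blast
    show ?thesis
    proof (cases "card M > 1")
      case True
      have Ma: "M \<subseteq> a ` ({1..card A} - {k})"
        using M a ex_index by blast
      have TL: "T = L n (card A) \<alpha> a k M (im n ` E)"
        unfolding L_def
      proof (rule T_eqI)
        fix \<epsilon> assume "\<epsilon> \<in> E"
        then show "\<epsilon> \<in> T_top n (card A) \<alpha> a k \<and> bb n \<alpha> \<epsilon> \<in> M \<and> im n \<epsilon> \<in> im n ` E"
          using E_top vid by (simp add: top M_def)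
      next
        fix \<epsilon> assume \<epsilon>: "\<epsilon> \<in> vidempotents n \<alpha>"
          and "\<epsilon> \<in> T_top n (card A) \<alpha> a k \<and> bb n \<alpha> \<epsilon> \<in> M \<and> im n \<epsilon> \<in> im n ` E"
        then obtain c g where c: "corank1 \<epsilon> (a k) c" "c \<in> M" and g: "g \<in> E" "im n \<epsilon> = im n g"
          by (auto simp: top corank1_tt_bb)
        \<comment> \<open>A second element of \<open>M\<close> supplies an idempotent with the same
          \<open>t\<close> and another \<open>b\<close>. It serves as \<open>f\<close> in
          \<open>ex_E_kernel\<close>, so the kernel of \<open>\<epsilon>\<close> occurs in
          \<open>E\<close>.\<close>
        obtain c' where c': "c' \<in> M" "c \<noteq> c'"
          using True c(2) by (metis card_1_singleton_iff One_nat_def is_singletonI' is_singleton_def less_irrefl all_not_in_conv)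
        have "\<exists>h\<in>E. corank1 h (a k) x" if "x \<in> M" for x
          using that E_top corank1_tt_bb(2) unfolding M_def by blast
        then obtain h h' where h: "h \<in> E" "corank1 h (a k) c" and h': "h' \<in> E" "corank1 h' (a k) c'"
          using c(2) c'(1) by blast
        obtain p where p: "p \<in> E" "kernel n \<epsilon> = kernel n p"
          using ex_E_kernel [OF h h' c'(2) c(1)] by blast
        show "\<epsilon> \<in> E"
          by (rule E_rectangle [OF p(1) g(1) c(1) p(2) g(2)])
      qed
      have ?L
      proof (rule bexI [OF _ k(1)], intro exI [of _ M] exI [of _ "im n ` E"] conjI)
      qed (fact Ma True ne(2) Y TL)+
      then show ?thesis by blast
    next
      case False
      have "b \<in> M"
        using e corank1_tt_bb(2) [OF e(2)] by (auto simp: M_def)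
      have "M = {b}"
      proof -
        have "finite M"
          using M fin_A by (rule finite_subset [OF _ finite_Diff])
        then show ?thesis
          using False \<open>b \<in> M\<close> card_le_Suc0_iff_eq [of M] by (auto simp: One_nat_def)
      qed
      have E_km: "corank1 g (a k) (a m)" if g: "g \<in> E" for g
      proof -
        obtain c where c: "corank1 g (a k) c"
          using E_top [OF g] by blast
        moreover have "bb n \<alpha> g = b"
          using g \<open>M = {b}\<close> by (auto simp: M_def)
        ultimately show ?thesis
          using corank1_tt_bb(2) [OF c] m(2) by simp
      qed
      have X: "kernel n ` E \<subseteq> U n (card A) \<alpha> a k m"
        using E_km corank1_kernel_in_U by blast
      \<comment> \<open>With \<open>t\<close> and \<open>b\<close> constant,
        \<open>E_rectangle\<close> alone fills every combination of an occurring kernel and an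
        occurring image.\<close>
      have TH: "T = H n (card A) \<alpha> a k m (kernel n ` E) (im n ` E)"
        unfolding H_def
      proof (rule T_eqI)
        fix \<epsilon> assume "\<epsilon> \<in> E"
        then show "\<epsilon> \<in> T_top_bot n (card A) \<alpha> a k m \<and> kernel n \<epsilon> \<in> kernel n ` E \<and> im n \<epsilon> \<in> im n ` E"
          using E_km vid by (simp add: top_bot)
      next
        fix \<epsilon> assume "\<epsilon> \<in> vidempotents n \<alpha>"
          and "\<epsilon> \<in> T_top_bot n (card A) \<alpha> a k m \<and> kernel n \<epsilon> \<in> kernel n ` E \<and> im n \<epsilon> \<in> im n ` E"
        then show "\<epsilon> \<in> E"
          using E_rectangle top_bot by blast
      qed
      have ?H
      proof (rule bexI [OF _ k(1)], rule bexI [OF _ m(1)],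
          intro exI [of _ "kernel n ` E"] exI [of _ "im n ` E"] conjI)
      qed (fact km ne X Y TH)+
      then show ?thesis by blast
    qed
  qed
qed

end

theorem corollary23:
  fixes n l :: nat and \<alpha> a :: "nat \<Rightarrow> nat" and T :: "(nat \<Rightarrow> nat) set"
  assumes "n \<ge> 1"
    and "\<alpha> \<in> idempotents (trans_maps n) (tmult n)"
    and "rank n \<alpha> = l" and "l \<ge> 2"
    and "bij_betw a {1..l} (im n \<alpha>)"
    and "isolated_subsemigroup (trans_maps n) (vmult n \<alpha>) T"
    and "T \<subseteq> T_stable n \<alpha> (l - 1)"
  shows "(\<exists>k\<in>{1..l}. \<exists>m\<in>{1..l}. \<exists>X Y. k \<noteq> m \<and>
            X \<noteq> {} \<and> X \<subseteq> U n l \<alpha> a k m \<and> Y \<noteq> {} \<and> Y \<subseteq> V n l \<alpha> a k \<and>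
            T = H n l \<alpha> a k m X Y)
       \<or> (\<exists>k\<in>{1..l}. \<exists>m\<in>{1..l}. \<exists>X. k \<noteq> m \<and>
            X \<noteq> {} \<and> X \<subseteq> U n l \<alpha> a k m \<and>
            T = K n l \<alpha> a k m X)
       \<or> (\<exists>k\<in>{1..l}. \<exists>M Y. M \<subseteq> a ` ({1..l} - {k}) \<and> card M > 1 \<and>
            Y \<noteq> {} \<and> Y \<subseteq> V n l \<alpha> a k \<and>
            T = L n l \<alpha> a k M Y)"
proof -
  have l: "l = card (im n \<alpha>)"
    using assms(3) by (simp add: rank_def)
  interpret isolated_corank1 n \<alpha> T
    using assms(2,4,6,7) by unfold_locales (simp_all only: l)
  show ?thesis
    using isolated_corank1_classification [of a] assms(5) by (simp only: l)
qed

end
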